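(* Work in intuitionistic (higher-order) type theory, i.e. the internal logic of an elementary topos. Assume that for every finite set $X$ and every function $f: X+1 \to X$, there exist $x, y \in X+1$ with $f(x) = f(y)$ and $x \neq y$. Then the law of the excluded middle holds: for every truth value (proposition) $u$, $u$ or not $u$.
   Context: Logic is intuitionistic. A set $X$ is finite (Kuratowski-finite) if it belongs to every family $\mathcal{Y}$ of sets that contains $\emptyset$ and satisfies: whenever $Z \in \mathcal{Y}$ and $a \in X$, then $Z \cup \{a\} \in \mathcal{Y}$. $X+1$ denotes the disjoint union (coproduct) of $X$ with a one-element set. $x \neq y$ means $\neg(x=y)$. *)

theory Defs
  imports Main
begin

text \<open>
  Isabelle/HOL is classical, so intuitionistic higher-order type theory is represented here as an
  object language with its own derivability relation.  The system is that of Lambek and Scott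
  (Introduction to Higher Order Categorical Logic, Part II) without the type of natural numbers,
  which an arbitrary elementary topos need not have.  Arbitrary ground types \<open>'b\<close> and typed
  constants \<open>'c\<close> are allowed, so that the internal language of any given topos is an instance;
  the pure theory is the case of the empty signature.

  Variables are de Bruijn indices.  A context is the list of the types of the free variables,
  innermost first; it is part of the judgement because types may be empty.
\<close>

datatype 'b ty =
    Ground 'b
  | One
  | Omega
  | Power "'b ty"
  | Times "'b ty" "'b ty"

datatype ('b, 'c) tm =
    Var nat
  | Const 'c
  | Star
  | Tuple "('b, 'c) tm" "('b, 'c) tm"
  | Compr "'b ty" "('b, 'c) tm"
  | Mem "('b, 'c) tm" "('b, 'c) tm"       (infix "\<^bold>\<in>" 55)
  | Equal "('b, 'c) tm" "('b, 'c) tm"     (infix "\<^bold>=" 55)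
  | Truth
  | Falsity
  | Conj "('b, 'c) tm" "('b, 'c) tm"      (infixr "\<^bold>\<and>" 45)
  | Disj "('b, 'c) tm" "('b, 'c) tm"      (infixr "\<^bold>\<or>" 40)
  | Impl "('b, 'c) tm" "('b, 'c) tm"      (infixr "\<^bold>\<longrightarrow>" 35)
  | Forall "'b ty" "('b, 'c) tm"
  | Exists "'b ty" "('b, 'c) tm"

abbreviation Neg :: "('b, 'c) tm \<Rightarrow> ('b, 'c) tm" where
  "Neg \<phi> \<equiv> \<phi> \<^bold>\<longrightarrow> Falsity"

abbreviation Iff :: "('b, 'c) tm \<Rightarrow> ('b, 'c) tm \<Rightarrow> ('b, 'c) tm"  (infixr "\<^bold>\<longleftrightarrow>" 35) where
  "\<phi> \<^bold>\<longleftrightarrow> \<psi> \<equiv> (\<phi> \<^bold>\<longrightarrow> \<psi>) \<^bold>\<and> (\<psi> \<^bold>\<longrightarrow> \<phi>)"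

text \<open>\<open>lift k t\<close> inserts a fresh variable at index \<open>k\<close>; \<open>subst k s t\<close> replaces the variable with
  index \<open>k\<close> by \<open>s\<close> and closes the gap.\<close>

primrec lift :: "nat \<Rightarrow> ('b, 'c) tm \<Rightarrow> ('b, 'c) tm" where
  "lift k (Var i) = (if i < k then Var i else Var (Suc i))"
| "lift k (Const c) = Const c"
| "lift k Star = Star"
| "lift k (Tuple s t) = Tuple (lift k s) (lift k t)"
| "lift k (Compr A \<phi>) = Compr A (lift (Suc k) \<phi>)"
| "lift k (s \<^bold>\<in> t) = (lift k s \<^bold>\<in> lift k t)"
| "lift k (s \<^bold>= t) = (lift k s \<^bold>= lift k t)"
| "lift k Truth = Truth"
| "lift k Falsity = Falsity"
| "lift k (\<phi> \<^bold>\<and> \<psi>) = (lift k \<phi> \<^bold>\<and> lift k \<psi>)"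
| "lift k (\<phi> \<^bold>\<or> \<psi>) = (lift k \<phi> \<^bold>\<or> lift k \<psi>)"
| "lift k (\<phi> \<^bold>\<longrightarrow> \<psi>) = (lift k \<phi> \<^bold>\<longrightarrow> lift k \<psi>)"
| "lift k (Forall A \<phi>) = Forall A (lift (Suc k) \<phi>)"
| "lift k (Exists A \<phi>) = Exists A (lift (Suc k) \<phi>)"

primrec subst :: "nat \<Rightarrow> ('b, 'c) tm \<Rightarrow> ('b, 'c) tm \<Rightarrow> ('b, 'c) tm" where
  "subst k s (Var i) = (if i < k then Var i else if i = k then s else Var (i - 1))"
| "subst k s (Const c) = Const c"
| "subst k s Star = Star"
| "subst k s (Tuple t u) = Tuple (subst k s t) (subst k s u)"
| "subst k s (Compr A \<phi>) = Compr A (subst (Suc k) (lift 0 s) \<phi>)"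
| "subst k s (t \<^bold>\<in> u) = (subst k s t \<^bold>\<in> subst k s u)"
| "subst k s (t \<^bold>= u) = (subst k s t \<^bold>= subst k s u)"
| "subst k s Truth = Truth"
| "subst k s Falsity = Falsity"
| "subst k s (\<phi> \<^bold>\<and> \<psi>) = (subst k s \<phi> \<^bold>\<and> subst k s \<psi>)"
| "subst k s (\<phi> \<^bold>\<or> \<psi>) = (subst k s \<phi> \<^bold>\<or> subst k s \<psi>)"
| "subst k s (\<phi> \<^bold>\<longrightarrow> \<psi>) = (subst k s \<phi> \<^bold>\<longrightarrow> subst k s \<psi>)"
| "subst k s (Forall A \<phi>) = Forall A (subst (Suc k) (lift 0 s) \<phi>)"
| "subst k s (Exists A \<phi>) = Exists A (subst (Suc k) (lift 0 s) \<phi>)"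

text \<open>The signature \<open>S\<close> assigns a type to each constant in its domain; names outside the domain
  occur in no well-typed term.\<close>

inductive has_type :: "('c \<rightharpoonup> 'b ty) \<Rightarrow> 'b ty list \<Rightarrow> ('b, 'c) tm \<Rightarrow> 'b ty \<Rightarrow> bool"
  for S :: "'c \<rightharpoonup> 'b ty" where
  ty_Var: "i < length \<Delta> \<Longrightarrow> A = \<Delta> ! i \<Longrightarrow> has_type S \<Delta> (Var i) A"
| ty_Const: "S c = Some A \<Longrightarrow> has_type S \<Delta> (Const c) A"
| ty_Star: "has_type S \<Delta> Star One"
| ty_Tuple: "has_type S \<Delta> s A \<Longrightarrow> has_type S \<Delta> t B \<Longrightarrow> has_type S \<Delta> (Tuple s t) (Times A B)"
| ty_Compr: "has_type S (A # \<Delta>) \<phi> Omega \<Longrightarrow> has_type S \<Delta> (Compr A \<phi>) (Power A)"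
| ty_Mem: "has_type S \<Delta> s A \<Longrightarrow> has_type S \<Delta> t (Power A) \<Longrightarrow> has_type S \<Delta> (s \<^bold>\<in> t) Omega"
| ty_Equal: "has_type S \<Delta> s A \<Longrightarrow> has_type S \<Delta> t A \<Longrightarrow> has_type S \<Delta> (s \<^bold>= t) Omega"
| ty_Truth: "has_type S \<Delta> Truth Omega"
| ty_Falsity: "has_type S \<Delta> Falsity Omega"
| ty_Conj: "has_type S \<Delta> \<phi> Omega \<Longrightarrow> has_type S \<Delta> \<psi> Omega \<Longrightarrow> has_type S \<Delta> (\<phi> \<^bold>\<and> \<psi>) Omega"
| ty_Disj: "has_type S \<Delta> \<phi> Omega \<Longrightarrow> has_type S \<Delta> \<psi> Omega \<Longrightarrow> has_type S \<Delta> (\<phi> \<^bold>\<or> \<psi>) Omega"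
| ty_Impl: "has_type S \<Delta> \<phi> Omega \<Longrightarrow> has_type S \<Delta> \<psi> Omega \<Longrightarrow> has_type S \<Delta> (\<phi> \<^bold>\<longrightarrow> \<psi>) Omega"
| ty_Forall: "has_type S (A # \<Delta>) \<phi> Omega \<Longrightarrow> has_type S \<Delta> (Forall A \<phi>) Omega"
| ty_Exists: "has_type S (A # \<Delta>) \<phi> Omega \<Longrightarrow> has_type S \<Delta> (Exists A \<phi>) Omega"

text \<open>\<open>proves S \<Delta> \<Gamma> \<phi>\<close>: in the context \<open>\<Delta>\<close>, the formula \<open>\<phi>\<close> is intuitionistically derivable from
  the set \<open>\<Gamma>\<close> of assumptions.  The set may be infinite, so the axioms of a theory are taken as
  assumptions in the empty context.  Ill-typed members of \<open>\<Gamma>\<close> are unusable, by rule \<open>Hyp\<close>.\<close>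

inductive proves :: "('c \<rightharpoonup> 'b ty) \<Rightarrow> 'b ty list \<Rightarrow> ('b, 'c) tm set \<Rightarrow> ('b, 'c) tm \<Rightarrow> bool"
  for S :: "'c \<rightharpoonup> 'b ty" where
  Hyp: "\<phi> \<in> \<Gamma> \<Longrightarrow> has_type S \<Delta> \<phi> Omega \<Longrightarrow> proves S \<Delta> \<Gamma> \<phi>"
| TruthI: "proves S \<Delta> \<Gamma> Truth"
| FalsityE: "proves S \<Delta> \<Gamma> Falsity \<Longrightarrow> has_type S \<Delta> \<phi> Omega \<Longrightarrow> proves S \<Delta> \<Gamma> \<phi>"
| ConjI: "proves S \<Delta> \<Gamma> \<phi> \<Longrightarrow> proves S \<Delta> \<Gamma> \<psi> \<Longrightarrow> proves S \<Delta> \<Gamma> (\<phi> \<^bold>\<and> \<psi>)"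
| ConjE1: "proves S \<Delta> \<Gamma> (\<phi> \<^bold>\<and> \<psi>) \<Longrightarrow> proves S \<Delta> \<Gamma> \<phi>"
| ConjE2: "proves S \<Delta> \<Gamma> (\<phi> \<^bold>\<and> \<psi>) \<Longrightarrow> proves S \<Delta> \<Gamma> \<psi>"
| DisjI1: "proves S \<Delta> \<Gamma> \<phi> \<Longrightarrow> has_type S \<Delta> \<psi> Omega \<Longrightarrow> proves S \<Delta> \<Gamma> (\<phi> \<^bold>\<or> \<psi>)"
| DisjI2: "proves S \<Delta> \<Gamma> \<psi> \<Longrightarrow> has_type S \<Delta> \<phi> Omega \<Longrightarrow> proves S \<Delta> \<Gamma> (\<phi> \<^bold>\<or> \<psi>)"
| DisjE: "proves S \<Delta> \<Gamma> (\<phi> \<^bold>\<or> \<psi>) \<Longrightarrow> proves S \<Delta> (insert \<phi> \<Gamma>) \<chi> \<Longrightarrow> proves S \<Delta> (insert \<psi> \<Gamma>) \<chi>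
    \<Longrightarrow> proves S \<Delta> \<Gamma> \<chi>"
| ImplI: "has_type S \<Delta> \<phi> Omega \<Longrightarrow> proves S \<Delta> (insert \<phi> \<Gamma>) \<psi> \<Longrightarrow> proves S \<Delta> \<Gamma> (\<phi> \<^bold>\<longrightarrow> \<psi>)"
| ImplE: "proves S \<Delta> \<Gamma> (\<phi> \<^bold>\<longrightarrow> \<psi>) \<Longrightarrow> proves S \<Delta> \<Gamma> \<phi> \<Longrightarrow> proves S \<Delta> \<Gamma> \<psi>"
| ForallI: "proves S (A # \<Delta>) (lift 0 ` \<Gamma>) \<phi> \<Longrightarrow> proves S \<Delta> \<Gamma> (Forall A \<phi>)"
| ForallE: "proves S \<Delta> \<Gamma> (Forall A \<phi>) \<Longrightarrow> has_type S \<Delta> t A \<Longrightarrow> proves S \<Delta> \<Gamma> (subst 0 t \<phi>)"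
| ExistsI: "has_type S (A # \<Delta>) \<phi> Omega \<Longrightarrow> has_type S \<Delta> t A \<Longrightarrow> proves S \<Delta> \<Gamma> (subst 0 t \<phi>)
    \<Longrightarrow> proves S \<Delta> \<Gamma> (Exists A \<phi>)"
| ExistsE: "proves S \<Delta> \<Gamma> (Exists A \<phi>) \<Longrightarrow> has_type S \<Delta> \<chi> Omega
    \<Longrightarrow> proves S (A # \<Delta>) (insert \<phi> (lift 0 ` \<Gamma>)) (lift 0 \<chi>) \<Longrightarrow> proves S \<Delta> \<Gamma> \<chi>"
| EqualI: "has_type S \<Delta> t A \<Longrightarrow> proves S \<Delta> \<Gamma> (t \<^bold>= t)"
| EqualE: "has_type S (A # \<Delta>) \<phi> Omega \<Longrightarrow> has_type S \<Delta> s A \<Longrightarrow> has_type S \<Delta> t A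
    \<Longrightarrow> proves S \<Delta> \<Gamma> (s \<^bold>= t) \<Longrightarrow> proves S \<Delta> \<Gamma> (subst 0 s \<phi>) \<Longrightarrow> proves S \<Delta> \<Gamma> (subst 0 t \<phi>)"
| Comprehension: "has_type S (A # \<Delta>) \<phi> Omega \<Longrightarrow> has_type S \<Delta> t A
    \<Longrightarrow> proves S \<Delta> \<Gamma> ((t \<^bold>\<in> Compr A \<phi>) \<^bold>\<longleftrightarrow> subst 0 t \<phi>)"
| Extensionality: "has_type S \<Delta> s (Power A) \<Longrightarrow> has_type S \<Delta> t (Power A)
    \<Longrightarrow> proves S \<Delta> \<Gamma> (Forall A ((Var 0 \<^bold>\<in> lift 0 s) \<^bold>\<longleftrightarrow> (Var 0 \<^bold>\<in> lift 0 t)))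
    \<Longrightarrow> proves S \<Delta> \<Gamma> (s \<^bold>= t)"
| Prop_Extensionality: "proves S \<Delta> \<Gamma> (\<phi> \<^bold>\<longleftrightarrow> \<psi>) \<Longrightarrow> proves S \<Delta> \<Gamma> (\<phi> \<^bold>= \<psi>)"
| One_Unique: "has_type S \<Delta> t One \<Longrightarrow> proves S \<Delta> \<Gamma> (t \<^bold>= Star)"
| Tuple_Inject1: "proves S \<Delta> \<Gamma> (Tuple s t \<^bold>= Tuple u v) \<Longrightarrow> proves S \<Delta> \<Gamma> (s \<^bold>= u)"
| Tuple_Inject2: "proves S \<Delta> \<Gamma> (Tuple s t \<^bold>= Tuple u v) \<Longrightarrow> proves S \<Delta> \<Gamma> (t \<^bold>= v)"
| Tuple_Exhaust: "has_type S \<Delta> t (Times A B)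
    \<Longrightarrow> proves S \<Delta> \<Gamma> (Exists A (Exists B (lift 0 (lift 0 t) \<^bold>= Tuple (Var 1) (Var 0))))"

text \<open>As usual in this type theory, a set is a term of a type \<open>Power A\<close>.  The parameters of the
  following notions are terms of the ambient context, hence lifted under each binder.\<close>

abbreviation lift2 :: "('b, 'c) tm \<Rightarrow> ('b, 'c) tm" where
  "lift2 t \<equiv> lift 0 (lift 0 t)"

abbreviation lift3 :: "('b, 'c) tm \<Rightarrow> ('b, 'c) tm" where
  "lift3 t \<equiv> lift 0 (lift 0 (lift 0 t))"

definition Empty :: "'b ty \<Rightarrow> ('b, 'c) tm" where
  "Empty A = Compr A Falsity"

definition Single :: "'b ty \<Rightarrow> ('b, 'c) tm \<Rightarrow> ('b, 'c) tm" where
  "Single A a = Compr A (Var 0 \<^bold>= lift 0 a)"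

definition Binunion :: "'b ty \<Rightarrow> ('b, 'c) tm \<Rightarrow> ('b, 'c) tm \<Rightarrow> ('b, 'c) tm" where
  "Binunion A Y Z = Compr A ((Var 0 \<^bold>\<in> lift 0 Y) \<^bold>\<or> (Var 0 \<^bold>\<in> lift 0 Z))"

text \<open>In \<open>Finite A X\<close> the outer variable is the family \<open>\<Y>\<close>; in the closure condition \<open>Var 2\<close> is
  \<open>\<Y>\<close>, \<open>Var 1\<close> is \<open>Z\<close> and \<open>Var 0\<close> is \<open>a\<close>.\<close>

definition Finite :: "'b ty \<Rightarrow> ('b, 'c) tm \<Rightarrow> ('b, 'c) tm" where
  "Finite A X =
    Forall (Power (Power A))
      ((Empty A \<^bold>\<in> Var 0) \<^bold>\<and>
       Forall (Power A) (Forall A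
         ((Var 1 \<^bold>\<in> Var 2) \<^bold>\<and> (Var 0 \<^bold>\<in> lift3 X) \<^bold>\<longrightarrow>
          (Binunion A (Var 1) (Single A (Var 0)) \<^bold>\<in> Var 2)))
       \<^bold>\<longrightarrow> (lift 0 X \<^bold>\<in> Var 0))"

text \<open>The coproduct of \<open>X\<close> (of type \<open>Power A\<close>) and \<open>Y\<close> (of type \<open>Power B\<close>) is the set of all pairs
  \<open>({x}, {})\<close> with \<open>x\<close> in \<open>X\<close> and \<open>({}, {y})\<close> with \<open>y\<close> in \<open>Y\<close>; this is the usual construction
  of coproducts in a topos.\<close>

abbreviation Plus_ty :: "'b ty \<Rightarrow> 'b ty \<Rightarrow> 'b ty" where
  "Plus_ty A B \<equiv> Times (Power A) (Power B)"

definition In_left :: "'b ty \<Rightarrow> 'b ty \<Rightarrow> ('b, 'c) tm \<Rightarrow> ('b, 'c) tm" where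
  "In_left A B a = Tuple (Single A a) (Empty B)"

definition In_right :: "'b ty \<Rightarrow> 'b ty \<Rightarrow> ('b, 'c) tm \<Rightarrow> ('b, 'c) tm" where
  "In_right A B b = Tuple (Empty A) (Single B b)"

definition Plus :: "'b ty \<Rightarrow> 'b ty \<Rightarrow> ('b, 'c) tm \<Rightarrow> ('b, 'c) tm \<Rightarrow> ('b, 'c) tm" where
  "Plus A B X Y = Compr (Plus_ty A B)
    (Exists A ((Var 0 \<^bold>\<in> lift2 X) \<^bold>\<and> (Var 1 \<^bold>= In_left A B (Var 0))) \<^bold>\<or>
     Exists B ((Var 0 \<^bold>\<in> lift2 Y) \<^bold>\<and> (Var 1 \<^bold>= In_right A B (Var 0))))"

definition Plus_one :: "'b ty \<Rightarrow> ('b, 'c) tm \<Rightarrow> ('b, 'c) tm" where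
  "Plus_one A X = Plus A One X (Single One Star)"

text \<open>\<open>Function A B X Y f\<close>: \<open>f\<close> is the graph of a function from the set \<open>X\<close> to the set \<open>Y\<close>, that
  is, \<open>f\<close> is contained in the product of \<open>X\<close> and \<open>Y\<close>, and for each \<open>x\<close> in \<open>X\<close> there is a unique
  \<open>y\<close> with \<open>(x, y)\<close> in \<open>f\<close>.\<close>

definition Function ::
    "'b ty \<Rightarrow> 'b ty \<Rightarrow> ('b, 'c) tm \<Rightarrow> ('b, 'c) tm \<Rightarrow> ('b, 'c) tm \<Rightarrow> ('b, 'c) tm" where
  "Function A B X Y f =
   ((Forall A (Forall B
       ((Tuple (Var 1) (Var 0) \<^bold>\<in> lift2 f) \<^bold>\<longrightarrow> (Var 1 \<^bold>\<in> lift2 X) \<^bold>\<and> (Var 0 \<^bold>\<in> lift2 Y)))) \<^bold>\<and>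
    (Forall A ((Var 0 \<^bold>\<in> lift 0 X) \<^bold>\<longrightarrow>
       Exists B ((Tuple (Var 1) (Var 0) \<^bold>\<in> lift2 f) \<^bold>\<and>
         Forall B ((Tuple (Var 2) (Var 0) \<^bold>\<in> lift3 f) \<^bold>\<longrightarrow> (Var 0 \<^bold>= Var 1))))))"

text \<open>Given that \<open>f\<close> is the graph of a function with values in type \<open>B\<close> and that \<open>x\<close>, \<open>y\<close> lie in
  its domain, this says that its values at \<open>x\<close> and \<open>y\<close> are equal.\<close>

definition Same_value ::
    "'b ty \<Rightarrow> ('b, 'c) tm \<Rightarrow> ('b, 'c) tm \<Rightarrow> ('b, 'c) tm \<Rightarrow> ('b, 'c) tm" where
  "Same_value B f x y =
    Exists B ((Tuple (lift 0 x) (Var 0) \<^bold>\<in> lift 0 f) \<^bold>\<and> (Tuple (lift 0 y) (Var 0) \<^bold>\<in> lift 0 f))"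

text \<open>The pigeonhole principle for the finite sets of elements of type \<open>A\<close>: for every finite \<open>X\<close>
  and every \<open>f : X + 1 \<rightarrow> X\<close> there are \<open>x\<close>, \<open>y\<close> in \<open>X + 1\<close> with \<open>f x = f y\<close> and \<open>x \<noteq> y\<close>.  Under
  the existential quantifiers, \<open>Var 3\<close>, \<open>Var 2\<close>, \<open>Var 1\<close>, \<open>Var 0\<close> are \<open>X\<close>, \<open>f\<close>, \<open>x\<close>, \<open>y\<close>.\<close>

definition Pigeonhole :: "'b ty \<Rightarrow> ('b, 'c) tm" where
  "Pigeonhole A =
    Forall (Power A) (Finite A (Var 0) \<^bold>\<longrightarrow>
      Forall (Power (Times (Plus_ty A One) A))
        (Function (Plus_ty A One) A (Plus_one A (Var 1)) (Var 1) (Var 0) \<^bold>\<longrightarrow>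
          Exists (Plus_ty A One) (Exists (Plus_ty A One)
            ((Var 1 \<^bold>\<in> Plus_one A (Var 3)) \<^bold>\<and> (Var 0 \<^bold>\<in> Plus_one A (Var 3)) \<^bold>\<and>
             Same_value A (Var 2) (Var 1) (Var 0) \<^bold>\<and> Neg (Var 1 \<^bold>= Var 0)))))"

definition Excluded_middle :: "('b, 'c) tm" where
  "Excluded_middle = Forall Omega (Var 0 \<^bold>\<or> Neg (Var 0))"

end

theory Submission
  imports Defs
begin

text \<open>Given a truth value \<open>u\<close>, let \<open>X = {u, \<top>}\<close>, a finite subset of \<open>\<Omega>\<close>, and let \<open>f\<close> send
  every point of the summand \<open>X\<close> of \<open>X + 1\<close> to \<open>\<top>\<close> and the extra point \<open>*\<close> to \<open>u\<close>.  The single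
  formula \<open>f x = (x = * \<longrightarrow> u)\<close> defines this function.  Suppose \<open>f x = f y\<close> and \<open>x \<noteq> y\<close>.  If one
  of the two points is \<open>*\<close> and the other is not, then \<open>u = \<top>\<close>.  If both lie in \<open>X\<close>, then
  \<open>u\<close> would make both equal to \<open>\<top>\<close>, so \<open>\<not> u\<close>.\<close>

section \<open>Substitution and typing\<close>

lemma lift_lift: "i \<le> k \<Longrightarrow> lift (Suc k) (lift i t) = lift i (lift k t)"
  by (induction t arbitrary: i k) auto

lemma lift_lift_0 [simp]: "lift (Suc k) (lift 0 t) = lift 0 (lift k t)"
  by (simp add: lift_lift)

lemma subst_lift [simp]: "subst k s (lift k t) = t"
  by (induction t arbitrary: k s) auto

lemma subst_Suc_lift: "i \<le> k \<Longrightarrow> subst (Suc k) (lift i s) (lift i t) = lift i (subst k s t)"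
proof (induction t arbitrary: i k s)
  case (Var n)
  then show ?case by (cases n) auto
\<comment> \<open>Each binder clause of \<open>subst\<close> turns \<open>s\<close> into
  \<open>lift 0 s\<close>; the reversed exchange rule brings this to the form that the induction
  hypothesis has.\<close>
qed (auto simp flip: lift_lift_0)

lemma subst_Suc_lift_0 [simp]: "subst (Suc k) (lift 0 s) (lift 0 t) = lift 0 (subst k s t)"
  by (simp add: subst_Suc_lift)

text \<open>Lifting at \<open>Suc k\<close> leaves the variable \<open>k\<close> alone, so putting
  \<open>Var k\<close> for it and closing the gap undoes the lift. This is needed when a motive is
  instantiated at the innermost variable.\<close>

lemma subst_Var_lift [simp]: "subst k (Var k) (lift (Suc k) t) = t"
  by (induction t arbitrary: k) auto

lemma lift_subst: "k \<le> i \<Longrightarrow> lift i (subst k s t) = subst k (lift i s) (lift (Suc i) t)"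
  by (induction t arbitrary: i k s) (auto simp flip: lift_lift_0)

lemma subst_Suc_0_lift2 [simp]: "subst (Suc 0) s (lift2 t) = lift 0 t"
  by (simp flip: lift_lift_0)

text \<open>The prefix \<open>\<Delta>1\<close> makes the induction go through: it grows by one type
  under each binder, and the position of the new variable moves with it.\<close>

lemma has_type_lift_append:
  "has_type S (\<Delta>1 @ \<Delta>2) t A \<Longrightarrow> has_type S (\<Delta>1 @ B # \<Delta>2) (lift (length \<Delta>1) t) A"
proof (induction "\<Delta>1 @ \<Delta>2" t A arbitrary: \<Delta>1 rule: has_type.induct)
  case (ty_Compr A \<phi>)
  show ?case using ty_Compr(2)[of "A # \<Delta>1"] by (auto intro: has_type.intros)
next
  case (ty_Forall A \<phi>)
  show ?case using ty_Forall(2)[of "A # \<Delta>1"] by (auto intro: has_type.intros)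
next
  case (ty_Exists A \<phi>)
  show ?case using ty_Exists(2)[of "A # \<Delta>1"] by (auto intro: has_type.intros)
qed (auto intro!: has_type.intros simp: nth_append Suc_diff_le)

lemma has_type_lift: "has_type S \<Delta> t A \<Longrightarrow> has_type S (B # \<Delta>) (lift 0 t) A"
  using has_type_lift_append[of S "[]"] by simp

lemma has_type_lift_1: "has_type S (C # \<Delta>) t A \<Longrightarrow> has_type S (C # B # \<Delta>) (lift (Suc 0) t) A"
  using has_type_lift_append[of S "[C]"] by simp

lemma has_type_subst_append:
  "has_type S (\<Delta>1 @ B # \<Delta>2) t A \<Longrightarrow> has_type S (\<Delta>1 @ \<Delta>2) s B
    \<Longrightarrow> has_type S (\<Delta>1 @ \<Delta>2) (subst (length \<Delta>1) s t) A"
proof (induction "\<Delta>1 @ B # \<Delta>2" t A arbitrary: \<Delta>1 s rule: has_type.induct)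
  case (ty_Var i A)
  then show ?case by (auto intro!: has_type.intros simp: nth_append nth_Cons')
next
  case (ty_Compr A \<phi>)
  show ?case using ty_Compr(2)[of "A # \<Delta>1"] has_type_lift[OF ty_Compr(3)]
    by (auto intro: has_type.intros)
next
  case (ty_Forall A \<phi>)
  show ?case using ty_Forall(2)[of "A # \<Delta>1"] has_type_lift[OF ty_Forall(3)]
    by (auto intro: has_type.intros)
next
  case (ty_Exists A \<phi>)
  show ?case using ty_Exists(2)[of "A # \<Delta>1"] has_type_lift[OF ty_Exists(3)]
    by (auto intro: has_type.intros)
qed (auto intro: has_type.intros)

lemma has_type_subst:
  "has_type S (B # \<Delta>) t A \<Longrightarrow> has_type S \<Delta> s B \<Longrightarrow> has_type S \<Delta> (subst 0 s t) A"
  using has_type_subst_append[of S "[]"] by simp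

section \<open>Derived rules\<close>

lemma proves_mono: "proves S \<Delta> \<Gamma> \<phi> \<Longrightarrow> \<Gamma> \<subseteq> \<Gamma>' \<Longrightarrow> proves S \<Delta> \<Gamma>' \<phi>"
proof (induction arbitrary: \<Gamma>' rule: proves.induct)
  case (DisjE \<Delta> \<Gamma> \<phi> \<psi> \<chi>)
  then show ?case by (meson insert_mono proves.DisjE)
next
  case (ImplI \<Delta> \<phi> \<Gamma> \<psi>)
  then show ?case by (meson insert_mono proves.ImplI)
next
  case (ForallI A \<Delta> \<Gamma> \<phi>)
  then show ?case by (meson image_mono proves.ForallI)
next
  case (ExistsE \<Delta> \<Gamma> A \<phi> \<chi>)
  then show ?case by (meson image_mono insert_mono proves.ExistsE)
qed (blast intro: proves.intros)+

lemma weaken: "proves S \<Delta> \<Gamma> \<phi> \<Longrightarrow> proves S \<Delta> (insert \<psi> \<Gamma>) \<phi>"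
  by (blast intro: proves_mono)

lemma cut:
  "has_type S \<Delta> \<phi> Omega \<Longrightarrow> proves S \<Delta> \<Gamma> \<phi> \<Longrightarrow> proves S \<Delta> (insert \<phi> \<Gamma>) \<psi> \<Longrightarrow> proves S \<Delta> \<Gamma> \<psi>"
  by (blast intro: proves.intros)

text \<open>The motive \<open>\<phi>\<close> can hardly be found by unification against
  \<open>subst\<close>, so its two instances appear as equations, to be checked by simplification
  once the motive is given.\<close>

lemma Equal_subst:
  assumes "proves S \<Delta> \<Gamma> (s \<^bold>= t)" "proves S \<Delta> \<Gamma> \<psi>" "\<psi> = subst 0 s \<phi>" "\<chi> = subst 0 t \<phi>"
    "has_type S (A # \<Delta>) \<phi> Omega" "has_type S \<Delta> s A" "has_type S \<Delta> t A"
  shows "proves S \<Delta> \<Gamma> \<chi>"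
  using assms by (blast intro: proves.EqualE)

lemma Equal_sym:
  assumes "has_type S \<Delta> s A" "has_type S \<Delta> t A" "proves S \<Delta> \<Gamma> (s \<^bold>= t)"
  shows "proves S \<Delta> \<Gamma> (t \<^bold>= s)"
  using assms
  by (intro Equal_subst[where \<phi> = "Var 0 \<^bold>= lift 0 s", OF assms(3) EqualI])
    (auto intro!: has_type.intros has_type_lift)

lemma Equal_trans:
  assumes "has_type S \<Delta> r A" "has_type S \<Delta> s A" "has_type S \<Delta> t A"
    "proves S \<Delta> \<Gamma> (r \<^bold>= s)" "proves S \<Delta> \<Gamma> (s \<^bold>= t)"
  shows "proves S \<Delta> \<Gamma> (r \<^bold>= t)"
  using assms
  by (intro Equal_subst[where \<phi> = "lift 0 r \<^bold>= Var 0", OF assms(5,4)])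
    (auto intro!: has_type.intros has_type_lift)

lemma Mem_cong:
  assumes "has_type S \<Delta> s A" "has_type S \<Delta> t A" "has_type S \<Delta> X (Power A)"
    "proves S \<Delta> \<Gamma> (s \<^bold>= t)" "proves S \<Delta> \<Gamma> (s \<^bold>\<in> X)"
  shows "proves S \<Delta> \<Gamma> (t \<^bold>\<in> X)"
  using assms
  by (intro Equal_subst[where \<phi> = "Var 0 \<^bold>\<in> lift 0 X", OF assms(4,5)])
    (auto intro!: has_type.intros has_type_lift)

text \<open>Both halves of \<open>Comprehension\<close>, combined into an equivalence of
  derivability so that later proofs can rewrite with it.\<close>

lemma Mem_Compr:
  assumes "has_type S (A # \<Delta>) \<phi> Omega" "has_type S \<Delta> t A"
  shows "proves S \<Delta> \<Gamma> (t \<^bold>\<in> Compr A \<phi>) \<longleftrightarrow> proves S \<Delta> \<Gamma> (subst 0 t \<phi>)"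
  using Comprehension[OF assms] by (blast intro: proves.intros)

lemma Mem_Empty:
  "has_type S \<Delta> t A \<Longrightarrow> proves S \<Delta> \<Gamma> (t \<^bold>\<in> Empty A) \<longleftrightarrow> proves S \<Delta> \<Gamma> Falsity"
  unfolding Empty_def by (subst Mem_Compr) (auto intro: has_type.intros)

lemma Mem_Single:
  "has_type S \<Delta> t A \<Longrightarrow> has_type S \<Delta> a A
    \<Longrightarrow> proves S \<Delta> \<Gamma> (t \<^bold>\<in> Single A a) \<longleftrightarrow> proves S \<Delta> \<Gamma> (t \<^bold>= a)"
  unfolding Single_def by (subst Mem_Compr) (auto intro!: has_type.intros has_type_lift)

lemma Mem_Binunion:
  "has_type S \<Delta> t A \<Longrightarrow> has_type S \<Delta> Y (Power A) \<Longrightarrow> has_type S \<Delta> Z (Power A)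
    \<Longrightarrow> proves S \<Delta> \<Gamma> (t \<^bold>\<in> Binunion A Y Z) \<longleftrightarrow> proves S \<Delta> \<Gamma> ((t \<^bold>\<in> Y) \<^bold>\<or> (t \<^bold>\<in> Z))"
  unfolding Binunion_def by (subst Mem_Compr) (auto intro!: has_type.intros has_type_lift)

lemma Equal_TruthI: "has_type S \<Delta> \<phi> Omega \<Longrightarrow> proves S \<Delta> \<Gamma> \<phi> \<Longrightarrow> proves S \<Delta> \<Gamma> (\<phi> \<^bold>= Truth)"
  by (auto intro!: Prop_Extensionality ConjI ImplI TruthI has_type.intros intro: weaken)

lemma Equal_propD:
  assumes "has_type S \<Delta> \<phi> Omega" "has_type S \<Delta> \<psi> Omega"
    "proves S \<Delta> \<Gamma> (\<phi> \<^bold>= \<psi>)" "proves S \<Delta> \<Gamma> \<phi>"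
  shows "proves S \<Delta> \<Gamma> \<psi>"
  using assms
  by (intro Equal_subst[where \<phi> = "Var 0", OF assms(3,4)]) (auto intro!: has_type.intros)

section \<open>Finite sets, coproducts and graphs\<close>

text \<open>The definitions lift their parameters under their own binders, which is what makes
  \<open>lift\<close> commute with them. With these rules and those for \<open>subst\<close>, the
  notions can mostly stay folded.\<close>

lemma lift_defs [simp]:
  "lift k (Empty A) = Empty A"
  "lift k (Single A a) = Single A (lift k a)"
  "lift k (Binunion A Y Z) = Binunion A (lift k Y) (lift k Z)"
  "lift k (In_left A B a) = In_left A B (lift k a)"
  "lift k (In_right A B b) = In_right A B (lift k b)"
  "lift k (Plus A B X Y) = Plus A B (lift k X) (lift k Y)"
  "lift k (Plus_one A X) = Plus_one A (lift k X)"
  "lift k (Finite A X) = Finite A (lift k X)"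
  "lift k (Function A B X Y f) = Function A B (lift k X) (lift k Y) (lift k f)"
  "lift k (Same_value B f x y) = Same_value B (lift k f) (lift k x) (lift k y)"
  by (simp_all add: Empty_def Single_def Binunion_def In_left_def In_right_def Plus_def
      Plus_one_def Finite_def Function_def Same_value_def)

lemma subst_defs [simp]:
  "subst k s (Empty A) = Empty A"
  "subst k s (Single A a) = Single A (subst k s a)"
  "subst k s (Binunion A Y Z) = Binunion A (subst k s Y) (subst k s Z)"
  "subst k s (In_left A B a) = In_left A B (subst k s a)"
  "subst k s (In_right A B b) = In_right A B (subst k s b)"
  "subst k s (Plus A B X Y) = Plus A B (subst k s X) (subst k s Y)"
  "subst k s (Plus_one A X) = Plus_one A (subst k s X)"
  "subst k s (Finite A X) = Finite A (subst k s X)"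
  "subst k s (Function A B X Y f) = Function A B (subst k s X) (subst k s Y) (subst k s f)"
  "subst k s (Same_value B f x y) = Same_value B (subst k s f) (subst k s x) (subst k s y)"
  by (simp_all add: Empty_def Single_def Binunion_def In_left_def In_right_def Plus_def
      Plus_one_def Finite_def Function_def Same_value_def)

lemma has_type_defs:
  "has_type S \<Delta> (Empty A) (Power A)"
  "has_type S \<Delta> a A \<Longrightarrow> has_type S \<Delta> (Single A a) (Power A)"
  "has_type S \<Delta> Y (Power A) \<Longrightarrow> has_type S \<Delta> Z (Power A)
    \<Longrightarrow> has_type S \<Delta> (Binunion A Y Z) (Power A)"
  "has_type S \<Delta> a A \<Longrightarrow> has_type S \<Delta> (In_left A B a) (Plus_ty A B)"
  "has_type S \<Delta> b B \<Longrightarrow> has_type S \<Delta> (In_right A B b) (Plus_ty A B)"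
  "has_type S \<Delta> X (Power A) \<Longrightarrow> has_type S \<Delta> Y (Power B)
    \<Longrightarrow> has_type S \<Delta> (Plus A B X Y) (Power (Plus_ty A B))"
  "has_type S \<Delta> X (Power A) \<Longrightarrow> has_type S \<Delta> (Plus_one A X) (Power (Plus_ty A One))"
  "has_type S \<Delta> X (Power A) \<Longrightarrow> has_type S \<Delta> (Finite A X) Omega"
  "has_type S \<Delta> X (Power A) \<Longrightarrow> has_type S \<Delta> Y (Power B) \<Longrightarrow> has_type S \<Delta> f (Power (Times A B))
    \<Longrightarrow> has_type S \<Delta> (Function A B X Y f) Omega"
  "has_type S \<Delta> f (Power (Times A B)) \<Longrightarrow> has_type S \<Delta> x A \<Longrightarrow> has_type S \<Delta> y A
    \<Longrightarrow> has_type S \<Delta> (Same_value B f x y) Omega"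
  by (auto simp: Empty_def Single_def Binunion_def In_left_def In_right_def Plus_def
      Plus_one_def Finite_def Function_def Same_value_def intro!: has_type.intros has_type_lift)

lemmas typing = has_type.intros has_type_defs has_type_lift has_type_lift_1 has_type_subst

section \<open>Two-element sets\<close>

text \<open>Built from \<open>Empty\<close> by adjoining one element at a time, which is the shape
  produced by the closure condition in \<open>Finite\<close>.\<close>

definition Doubleton :: "'b ty \<Rightarrow> ('b, 'c) tm \<Rightarrow> ('b, 'c) tm \<Rightarrow> ('b, 'c) tm" where
  "Doubleton A a b = Binunion A (Binunion A (Empty A) (Single A a)) (Single A b)"

lemma lift_Doubleton [simp]: "lift k (Doubleton A a b) = Doubleton A (lift k a) (lift k b)"
  by (simp add: Doubleton_def)

lemma subst_Doubleton [simp]: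
  "subst k s (Doubleton A a b) = Doubleton A (subst k s a) (subst k s b)"
  by (simp add: Doubleton_def)

lemma has_type_Doubleton:
  "has_type S \<Delta> a A \<Longrightarrow> has_type S \<Delta> b A \<Longrightarrow> has_type S \<Delta> (Doubleton A a b) (Power A)"
  by (simp add: Doubleton_def typing)

lemma DoubletonI1:
  assumes "has_type S \<Delta> t A" "has_type S \<Delta> a A" "has_type S \<Delta> b A" "proves S \<Delta> \<Gamma> (t \<^bold>= a)"
  shows "proves S \<Delta> \<Gamma> (t \<^bold>\<in> Doubleton A a b)"
  using assms unfolding Doubleton_def
  by (simp add: Mem_Binunion typing Mem_Single DisjI1 DisjI2)

lemma DoubletonI2:
  assumes "has_type S \<Delta> t A" "has_type S \<Delta> a A" "has_type S \<Delta> b A" "proves S \<Delta> \<Gamma> (t \<^bold>= b)"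
  shows "proves S \<Delta> \<Gamma> (t \<^bold>\<in> Doubleton A a b)"
  using assms unfolding Doubleton_def
  by (simp add: Mem_Binunion typing Mem_Single DisjI2)

text \<open>The nested unions give three cases; the extra one, membership in \<open>Empty\<close>,
  is absurd.\<close>

lemma DoubletonE:
  assumes t: "has_type S \<Delta> t A" and a: "has_type S \<Delta> a A" and b: "has_type S \<Delta> b A"
    and mem: "proves S \<Delta> \<Gamma> (t \<^bold>\<in> Doubleton A a b)"
    and left: "proves S \<Delta> (insert (t \<^bold>= a) \<Gamma>) \<chi>" and right: "proves S \<Delta> (insert (t \<^bold>= b) \<Gamma>) \<chi>"
  shows "proves S \<Delta> \<Gamma> \<chi>"
proof -
  let ?Z = "Binunion A (Empty A) (Single A a)"
  have Z: "proves S \<Delta> \<Gamma>' (t \<^bold>= a)" if "(t \<^bold>\<in> ?Z) \<in> \<Gamma>'" for \<Gamma>'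
  proof -
    have "proves S \<Delta> \<Gamma>' (t \<^bold>\<in> ?Z)"
      by (rule Hyp[OF that]) (use t a in \<open>auto intro!: typing\<close>)
    then have "proves S \<Delta> \<Gamma>' ((t \<^bold>\<in> Empty A) \<^bold>\<or> (t \<^bold>\<in> Single A a))"
      using t a by (simp add: Mem_Binunion typing)
    moreover have "proves S \<Delta> (insert (t \<^bold>\<in> Empty A) \<Gamma>') (t \<^bold>= a)"
      by (rule FalsityE[OF Mem_Empty[OF t, THEN iffD1, OF Hyp]]) (use t a in \<open>auto intro!: typing\<close>)
    moreover have "proves S \<Delta> (insert (t \<^bold>\<in> Single A a) \<Gamma>') (t \<^bold>= a)"
      by (rule Mem_Single[OF t a, THEN iffD1, OF Hyp]) (use t a in \<open>auto intro!: typing\<close>)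
    ultimately show ?thesis by (rule DisjE)
  qed
  have "proves S \<Delta> (insert (t \<^bold>\<in> ?Z) \<Gamma>) \<chi>"
    by (rule cut[OF _ Z proves_mono[OF left]]) (use t a in \<open>auto intro!: typing\<close>)
  moreover have "proves S \<Delta> (insert (t \<^bold>\<in> Single A b) \<Gamma>) \<chi>"
    by (rule cut[OF _ Mem_Single[OF t b, THEN iffD1, OF Hyp] proves_mono[OF right]])
      (use t b in \<open>auto intro!: typing\<close>)
  moreover have "proves S \<Delta> \<Gamma> ((t \<^bold>\<in> ?Z) \<^bold>\<or> (t \<^bold>\<in> Single A b))"
    using mem t a b by (simp add: Doubleton_def Mem_Binunion typing)
  ultimately show ?thesis by (rule DisjE[rotated])
qed

text \<open>A family closed in the sense of \<open>Finite\<close> contains \<open>Empty\<close>, and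
  so, after \<open>a\<close> and then \<open>b\<close> are adjoined, the whole set. Each may be
  adjoined because it belongs to that set.\<close>

lemma Finite_Doubleton:
  assumes a: "has_type S \<Delta> a A" and b: "has_type S \<Delta> b A"
  shows "proves S \<Delta> \<Gamma> (Finite A (Doubleton A a b))"
proof -
  let ?D = "Power (Power A) # \<Delta>" and ?X = "Doubleton A a b"
  let ?step = "Forall (Power A) (Forall A
    ((Var 1 \<^bold>\<in> Var 2) \<^bold>\<and> (Var 0 \<^bold>\<in> lift3 ?X) \<^bold>\<longrightarrow>
      (Binunion A (Var 1) (Single A (Var 0)) \<^bold>\<in> Var 2)))"
  let ?H = "(Empty A \<^bold>\<in> Var 0) \<^bold>\<and> ?step"
  let ?G = "insert ?H (lift 0 ` \<Gamma>)"
  have H_type: "has_type S ?D ?H Omega"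
    using a b by (auto intro!: typing has_type_Doubleton)
  then have H: "proves S ?D ?G ?H"
    by (simp add: Hyp)
  \<comment> \<open>The closure condition on the family \<open>Var 0\<close>, as a rule for
    arbitrary terms \<open>Z\<close> and \<open>c\<close>.\<close>
  have step: "proves S ?D ?G (Binunion A Z (Single A c) \<^bold>\<in> Var 0)"
    if Z: "has_type S ?D Z (Power A)" "proves S ?D ?G (Z \<^bold>\<in> Var 0)"
      and c: "has_type S ?D c A" "proves S ?D ?G (c \<^bold>\<in> lift 0 ?X)" for Z c
  proof -
    have "proves S ?D ?G ((Z \<^bold>\<in> Var 0) \<^bold>\<and> (c \<^bold>\<in> lift 0 ?X) \<^bold>\<longrightarrow>
        (Binunion A Z (Single A c) \<^bold>\<in> Var 0))"
      \<comment> \<open>The first substitution must be pushed through the inner quantifier before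
        the second \<open>ForallE\<close> can match.\<close>
      using ForallE[OF ForallE[OF ConjE2[OF H] Z(1), simplified subst.simps] c(1)]
      by (simp add: numeral_2_eq_2)
    then show ?thesis
      by (rule ImplE[OF _ ConjI[OF Z(2) c(2)]])
  qed
  have X: "lift 0 ?X = Binunion A (Binunion A (Empty A) (Single A (lift 0 a))) (Single A (lift 0 b))"
    by (simp add: Doubleton_def)
  have "proves S ?D ?G (lift 0 a \<^bold>\<in> lift 0 ?X)" "proves S ?D ?G (lift 0 b \<^bold>\<in> lift 0 ?X)"
    unfolding lift_Doubleton using a b
    by (auto intro!: typing EqualI DoubletonI1[of S _ "lift 0 a"] DoubletonI2[of S _ "lift 0 b"])
  then have "proves S ?D ?G
      (Binunion A (Binunion A (Empty A) (Single A (lift 0 a))) (Single A (lift 0 b)) \<^bold>\<in> Var 0)"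
    using a b ConjE1[OF H] by (intro step) (auto intro!: typing)
  from this[folded X] show ?thesis
    unfolding Finite_def by (intro ForallI ImplI H_type)
qed

section \<open>The coproduct with a one-element set\<close>

text \<open>Comparing first components, the equation would make \<open>Single A a\<close> empty,
  although it contains \<open>a\<close>.\<close>

lemma In_left_neq_In_right:
  assumes a: "has_type S \<Delta> a A" and b: "has_type S \<Delta> b B"
    and "proves S \<Delta> \<Gamma> (In_left A B a \<^bold>= In_right A B b)"
  shows "proves S \<Delta> \<Gamma> Falsity"
proof -
  have eq: "proves S \<Delta> \<Gamma> (Single A a \<^bold>= Empty A)"
    using assms(3) unfolding In_left_def In_right_def by (rule Tuple_Inject1)
  have "proves S \<Delta> \<Gamma> (a \<^bold>\<in> Single A a)"
    using a by (simp add: Mem_Single EqualI)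
  then have "proves S \<Delta> \<Gamma> (a \<^bold>\<in> Empty A)"
    by (rule Equal_subst[where \<phi> = "lift 0 a \<^bold>\<in> Var 0", OF eq]) (use a in \<open>auto intro!: typing\<close>)
  then show ?thesis
    using a by (simp add: Mem_Empty)
qed

text \<open>A point of the left summand comes from \<open>a\<close> or \<open>b\<close> by
  \<open>DoubletonE\<close>; one of the right summand comes from an element of \<open>One\<close>,
  hence from \<open>Star\<close>.\<close>

lemma Mem_Plus_one_DoubletonD:
  assumes t: "has_type S \<Delta> t (Plus_ty A One)" and a: "has_type S \<Delta> a A" and b: "has_type S \<Delta> b A"
    and mem: "proves S \<Delta> \<Gamma> (t \<^bold>\<in> Plus_one A (Doubleton A a b))"
  shows "proves S \<Delta> \<Gamma> ((t \<^bold>= In_left A One a) \<^bold>\<or> (t \<^bold>= In_left A One b) \<^bold>\<or> (t \<^bold>= In_right A One Star))"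
    (is "proves _ _ _ ?\<chi>")
proof (rule DisjE)
  let ?X = "Doubleton A a b"
  let ?L = "(Var 0 \<^bold>\<in> lift 0 ?X) \<^bold>\<and> (lift 0 t \<^bold>= In_left A One (Var 0))"
  let ?R = "(Var 0 \<^bold>\<in> Single One Star) \<^bold>\<and> (lift 0 t \<^bold>= In_right A One (Var 0))"
  note ty = t a b typing has_type_Doubleton
  show "proves S \<Delta> \<Gamma> (Exists A ?L \<^bold>\<or> Exists One ?R)"
    using mem unfolding Plus_one_def Plus_def
    by (subst (asm) Mem_Compr) (auto intro!: ty)
  have \<chi>: "has_type S \<Delta> ?\<chi> Omega"
    by (auto intro!: ty)
  let ?GL = "insert ?L (lift 0 ` insert (Exists A ?L) \<Gamma>)"
  have L: "proves S (A # \<Delta>) ?GL ?L"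
    by (rule Hyp) (auto intro!: ty)
  have eq: "proves S (A # \<Delta>) (insert (Var 0 \<^bold>= lift 0 c) ?GL)
      (lift 0 (t \<^bold>= In_left A One c))" if "has_type S \<Delta> c A" for c
    by (rule Equal_subst[where s = "Var 0" and t = "lift 0 c"
          and \<phi> = "lift2 t \<^bold>= In_left A One (Var 0)", OF Hyp ConjE2[OF weaken[OF L]]])
      (use that t in \<open>auto intro!: typing\<close>)
  have "proves S (A # \<Delta>) ?GL (Var 0 \<^bold>\<in> Doubleton A (lift 0 a) (lift 0 b))"
    using ConjE1[OF L] by (simp only: lift_Doubleton)
  then have "proves S (A # \<Delta>) ?GL (lift 0 ?\<chi>)"
  proof (rule DoubletonE[rotated 3])
    show "proves S (A # \<Delta>) (insert (Var 0 \<^bold>= lift 0 a) ?GL) (lift 0 ?\<chi>)"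
      \<comment> \<open>\<open>lift.simps(11)\<close> is the clause for disjunction. Only
        disjunctions are unfolded, so each disjunct keeps the outer \<open>lift 0\<close> with which
        \<open>eq\<close> is stated.\<close>
      unfolding lift.simps(11) by (rule DisjI1[OF eq[OF a]]) (auto intro!: ty)
    show "proves S (A # \<Delta>) (insert (Var 0 \<^bold>= lift 0 b) ?GL) (lift 0 ?\<chi>)"
      unfolding lift.simps(11) by (rule DisjI2[OF DisjI1[OF eq[OF b]]]) (auto intro!: ty)
  qed (auto intro!: ty)
  then show "proves S \<Delta> (insert (Exists A ?L) \<Gamma>) ?\<chi>"
    by (rule ExistsE[OF Hyp \<chi>, rotated -1]) (auto intro!: ty)
  let ?GR = "insert ?R (lift 0 ` insert (Exists One ?R) \<Gamma>)"
  have R: "proves S (One # \<Delta>) ?GR ?R"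
    by (rule Hyp) (auto intro!: ty)
  have "proves S (One # \<Delta>) ?GR (lift 0 t \<^bold>= In_right A One Star)"
    by (rule Equal_subst[where s = "Var 0" and t = Star
          and \<phi> = "lift2 t \<^bold>= In_right A One (Var 0)", OF One_Unique ConjE2[OF R]])
      (auto intro!: ty)
  then have "proves S (One # \<Delta>) ?GR (lift 0 ?\<chi>)"
    by (auto intro!: ty DisjI2)
  then show "proves S \<Delta> (insert (Exists One ?R) \<Gamma>) ?\<chi>"
    by (rule ExistsE[OF Hyp \<chi>, rotated -1]) (auto intro!: ty)
qed

section \<open>Graphs of functions given by terms\<close>

text \<open>The graph of the function on \<open>X\<close> that sends \<open>Var 0\<close> to \<open>r\<close>.\<close>

definition Graph :: "'b ty \<Rightarrow> 'b ty \<Rightarrow> ('b, 'c) tm \<Rightarrow> ('b, 'c) tm \<Rightarrow> ('b, 'c) tm" where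
  "Graph A B X r = Compr (Times A B)
    (Exists A ((Var 0 \<^bold>\<in> lift2 X) \<^bold>\<and> (Var 1 \<^bold>= Tuple (Var 0) (lift (Suc 0) r))))"

lemma lift_Graph [simp]: "lift k (Graph A B X r) = Graph A B (lift k X) (lift (Suc k) r)"
  by (simp add: Graph_def lift_lift)

lemma has_type_Graph:
  "has_type S \<Delta> X (Power A) \<Longrightarrow> has_type S (A # \<Delta>) r B
    \<Longrightarrow> has_type S \<Delta> (Graph A B X r) (Power (Times A B))"
  unfolding Graph_def by (auto intro!: typing)

text \<open>Injectivity of pairs forces the existential witness in \<open>Graph\<close> to be
  \<open>a\<close>, and hence \<open>y\<close> to be the value of \<open>r\<close> at
  \<open>a\<close>. Conversely \<open>a\<close> itself is a witness.\<close>

lemma Mem_Graph: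
  assumes a: "has_type S \<Delta> a A" and y: "has_type S \<Delta> y B"
    and X: "has_type S \<Delta> X (Power A)" and r: "has_type S (A # \<Delta>) r B"
  shows "proves S \<Delta> \<Gamma> (Tuple a y \<^bold>\<in> Graph A B X r) \<longleftrightarrow>
    proves S \<Delta> \<Gamma> (a \<^bold>\<in> X) \<and> proves S \<Delta> \<Gamma> (y \<^bold>= subst 0 a r)"
proof -
  note ty = a y X r typing
  let ?E = "(Var 0 \<^bold>\<in> lift 0 X) \<^bold>\<and> (Tuple (lift 0 a) (lift 0 y) \<^bold>= Tuple (Var 0) r)"
  let ?\<chi> = "(a \<^bold>\<in> X) \<^bold>\<and> (y \<^bold>= subst 0 a r)"
  have "proves S \<Delta> \<Gamma> (Tuple a y \<^bold>\<in> Graph A B X r) \<longleftrightarrow> proves S \<Delta> \<Gamma> (Exists A ?E)"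
    unfolding Graph_def by (subst Mem_Compr) (auto intro!: ty)
  also have "\<dots> \<longleftrightarrow> proves S \<Delta> \<Gamma> ?\<chi>"
  proof
    assume ex: "proves S \<Delta> \<Gamma> (Exists A ?E)"
    let ?G = "insert ?E (lift 0 ` \<Gamma>)"
    have E: "proves S (A # \<Delta>) ?G ?E"
      by (rule Hyp) (auto intro!: ty)
    have eq: "proves S (A # \<Delta>) ?G (Var 0 \<^bold>= lift 0 a)"
      by (rule Equal_sym[OF _ _ Tuple_Inject1[OF ConjE2[OF E]]]) (auto intro!: ty)
    \<comment> \<open>At \<open>Var 0\<close> the motive says that \<open>r\<close> is the lifted
      \<open>y\<close>; at \<open>lift 0 a\<close>, by \<open>lift_subst\<close>, it becomes the
      lifted equation for the value at \<open>a\<close>.\<close>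
    have "proves S (A # \<Delta>) ?G (lift 0 y \<^bold>= lift 0 (subst 0 a r))"
      by (rule Equal_subst[where \<phi> = "lift2 y \<^bold>= lift (Suc 0) r",
            OF eq Tuple_Inject2[OF ConjE2[OF E]]])
        (auto simp: lift_subst intro!: ty)
    moreover have "proves S (A # \<Delta>) ?G (lift 0 a \<^bold>\<in> lift 0 X)"
      by (rule Mem_cong[OF _ _ _ eq ConjE1[OF E]]) (auto intro!: ty)
    ultimately show "proves S \<Delta> \<Gamma> ?\<chi>"
      by (intro ExistsE[OF ex, where \<chi> = ?\<chi>]) (auto intro!: ty ConjI)
  next
    assume \<chi>: "proves S \<Delta> \<Gamma> ?\<chi>"
    have "proves S \<Delta> \<Gamma> (Tuple a y \<^bold>= Tuple a (subst 0 a r))"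
      by (rule Equal_subst[where \<phi> = "Tuple (lift 0 a) (lift 0 y) \<^bold>= Tuple (lift 0 a) (Var 0)",
            OF ConjE2[OF \<chi>] EqualI])
        (auto intro!: ty)
    then show "proves S \<Delta> \<Gamma> (Exists A ?E)"
      using ConjE1[OF \<chi>] by (intro ExistsI[where t = a]) (auto intro!: ty ConjI)
  qed
  also have "\<dots> \<longleftrightarrow> proves S \<Delta> \<Gamma> (a \<^bold>\<in> X) \<and> proves S \<Delta> \<Gamma> (y \<^bold>= subst 0 a r)"
    by (blast intro: ConjI ConjE1 ConjE2)
  finally show ?thesis .
qed

text \<open>For an argument \<open>Var 1\<close> and a value \<open>Var 0\<close>, a graph lifted
  twice has the body \<open>lift (Suc 0) (lift (Suc 0) r)\<close>; evaluated at the argument, this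
  is \<open>r\<close> moved past the value variable.\<close>

lemma subst_Var_1_lift: "subst 0 (Var (Suc 0)) (lift (Suc 0) (lift (Suc 0) r)) = lift 0 r"
  using lift_subst[of 0 0 "Var 0" "lift (Suc 0) r"] by simp

text \<open>Assuming \<open>maps\<close> by a cut carries it under binders, where \<open>ForallI\<close> and \<open>ExistsE\<close> lift the
  assumptions; no weakening by variables is then needed.\<close>

lemma Function_Graph:
  assumes X: "has_type S \<Delta> X (Power A)" and Y: "has_type S \<Delta> Y (Power B)"
    and r: "has_type S (A # \<Delta>) r B"
    and maps: "proves S \<Delta> \<Gamma> (Forall A ((Var 0 \<^bold>\<in> lift 0 X) \<^bold>\<longrightarrow> (r \<^bold>\<in> lift 0 Y)))"
  shows "proves S \<Delta> \<Gamma> (Function A B X Y (Graph A B X r))"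
proof (rule cut[OF _ maps])
  note ty = X Y r typing has_type_Graph
  let ?M = "Forall A ((Var 0 \<^bold>\<in> lift 0 X) \<^bold>\<longrightarrow> (r \<^bold>\<in> lift 0 Y))"
  let ?F = "Graph A B X r"
  show "has_type S \<Delta> ?M Omega"
    by (auto intro!: ty)
  let ?D = "B # A # \<Delta>"
  \<comment> \<open>Here \<open>Var 1\<close> is an argument and \<open>Var 0\<close> a value.
    \<open>\<Gamma>'\<close> is arbitrary, to fit the lifted and enlarged assumptions left by
    \<open>ForallI\<close> and \<open>ImplI\<close>.\<close>
  have val: "proves S ?D \<Gamma>' (Var 1 \<^bold>\<in> lift2 X) \<and> proves S ?D \<Gamma>' (Var 0 \<^bold>= lift 0 r)"
    if mem: "(Tuple (Var 1) (Var 0) \<^bold>\<in> lift2 ?F) \<in> \<Gamma>'" for \<Gamma>'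
  proof -
    have "proves S ?D \<Gamma>' (Tuple (Var 1) (Var 0) \<^bold>\<in> lift2 ?F)"
      by (rule Hyp[OF mem]) (auto intro!: ty)
    then show ?thesis
      by (subst (asm) lift_Graph, subst (asm) lift_Graph, subst (asm) Mem_Graph)
        (auto intro!: ty simp: subst_Var_1_lift)
  qed
  have range: "proves S ?D \<Gamma>' ((Var 1 \<^bold>\<in> lift2 X) \<^bold>\<and> (Var 0 \<^bold>\<in> lift2 Y))"
    if M: "lift2 ?M \<in> \<Gamma>'" and mem: "(Tuple (Var 1) (Var 0) \<^bold>\<in> lift2 ?F) \<in> \<Gamma>'" for \<Gamma>'
  proof -
    have 1: "proves S ?D \<Gamma>' (Var 1 \<^bold>\<in> lift2 X)" and 2: "proves S ?D \<Gamma>' (Var 0 \<^bold>= lift 0 r)"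
      using val[OF mem] by auto
    have "proves S ?D \<Gamma>' (lift2 ?M)"
      by (rule Hyp[OF M]) (auto intro!: ty)
    from ForallE[OF this[simplified lift.simps], of "Var 1"]
    have "proves S ?D \<Gamma>' ((Var 1 \<^bold>\<in> lift2 X) \<^bold>\<longrightarrow> (lift 0 r \<^bold>\<in> lift2 Y))"
      by (simp add: ty_Var subst_Var_1_lift)
    then have "proves S ?D \<Gamma>' (lift 0 r \<^bold>\<in> lift2 Y)"
      using 1 by (rule ImplE)
    then have "proves S ?D \<Gamma>' (Var 0 \<^bold>\<in> lift2 Y)"
      by (rule Mem_cong[of S ?D "lift 0 r" B, OF _ _ _ Equal_sym[of S ?D _ B, OF _ _ 2], rotated -1])
        (auto intro!: ty)
    with 1 show ?thesis by (rule ConjI)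
  qed
  have 1: "proves S \<Delta> (insert ?M \<Gamma>) (Forall A (Forall B
      ((Tuple (Var 1) (Var 0) \<^bold>\<in> lift2 ?F) \<^bold>\<longrightarrow> (Var 1 \<^bold>\<in> lift2 X) \<^bold>\<and> (Var 0 \<^bold>\<in> lift2 Y))))"
    by (intro ForallI ImplI range) (auto intro!: ty)
  have total: "proves S (A # \<Delta>) \<Gamma>' (Exists B ((Tuple (Var 1) (Var 0) \<^bold>\<in> lift2 ?F) \<^bold>\<and>
      Forall B ((Tuple (Var 2) (Var 0) \<^bold>\<in> lift3 ?F) \<^bold>\<longrightarrow> (Var 0 \<^bold>= Var 1))))"
    if mem: "(Var 0 \<^bold>\<in> lift 0 X) \<in> \<Gamma>'" for \<Gamma>'
  proof -
    have "proves S (A # \<Delta>) \<Gamma>' (Var 0 \<^bold>\<in> lift 0 X)"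
      by (rule Hyp[OF mem]) (auto intro!: ty)
    then have 1: "proves S (A # \<Delta>) \<Gamma>' (Tuple (Var 0) r \<^bold>\<in> lift 0 ?F)"
      by (subst lift_Graph, subst Mem_Graph) (auto intro!: ty EqualI[OF r])
    have 2: "proves S (A # \<Delta>) \<Gamma>'
        (Forall B ((Tuple (Var 1) (Var 0) \<^bold>\<in> lift2 ?F) \<^bold>\<longrightarrow> (Var 0 \<^bold>= lift 0 r)))"
      by (intro ForallI ImplI conjunct2[OF val]) (auto intro!: ty)
    \<comment> \<open>The witness is \<open>r\<close> itself, whose \<open>Var 0\<close> is here the
      argument.\<close>
    from ConjI[OF 1 2] show ?thesis
      by (intro ExistsI[OF _ r]) (auto intro!: ty simp: numeral_2_eq_2 simp del: lift_Graph)
  qed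
  have 2: "proves S \<Delta> (insert ?M \<Gamma>) (Forall A ((Var 0 \<^bold>\<in> lift 0 X) \<^bold>\<longrightarrow>
      Exists B ((Tuple (Var 1) (Var 0) \<^bold>\<in> lift2 ?F) \<^bold>\<and>
        Forall B ((Tuple (Var 2) (Var 0) \<^bold>\<in> lift3 ?F) \<^bold>\<longrightarrow> (Var 0 \<^bold>= Var 1)))))"
    by (intro ForallI ImplI total) (auto intro!: ty)
  from 1 2 show "proves S \<Delta> (insert ?M \<Gamma>) (Function A B X Y ?F)"
    unfolding Function_def by (rule ConjI)
qed

text \<open>The common value equals \<open>r\<close> at \<open>x\<close> and \<open>r\<close> at
  \<open>y\<close>. The equation between these two does not mention it, so \<open>ExistsE\<close>
  applies.\<close>

lemma Same_value_Graph:
  assumes X: "has_type S \<Delta> X (Power A)" and r: "has_type S (A # \<Delta>) r B"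
    and x: "has_type S \<Delta> x A" and y: "has_type S \<Delta> y A"
    and same: "proves S \<Delta> \<Gamma> (Same_value B (Graph A B X r) x y)"
  shows "proves S \<Delta> \<Gamma> (subst 0 x r \<^bold>= subst 0 y r)"
proof -
  note ty = X r x y typing has_type_Graph
  let ?F = "Graph A B X r"
  let ?E = "(Tuple (lift 0 x) (Var 0) \<^bold>\<in> lift 0 ?F) \<^bold>\<and> (Tuple (lift 0 y) (Var 0) \<^bold>\<in> lift 0 ?F)"
  let ?G = "insert ?E (lift 0 ` \<Gamma>)"
  have E: "proves S (B # \<Delta>) ?G ?E"
    by (rule Hyp) (auto intro!: ty)
  have val: "proves S (B # \<Delta>) ?G (Var 0 \<^bold>= lift 0 (subst 0 z r))"
    if "proves S (B # \<Delta>) ?G (Tuple (lift 0 z) (Var 0) \<^bold>\<in> lift 0 ?F)" "has_type S \<Delta> z A" for z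
    using that by (subst (asm) lift_Graph, subst (asm) Mem_Graph) (auto intro!: ty simp: lift_subst)
  have "proves S (B # \<Delta>) ?G (lift 0 (subst 0 x r) \<^bold>= lift 0 (subst 0 y r))"
    by (rule Equal_trans[OF _ _ _ Equal_sym[OF _ _ val[OF ConjE1[OF E] x]] val[OF ConjE2[OF E] y]])
      (auto intro!: ty)
  then show ?thesis
    using same unfolding Same_value_def
    by (intro ExistsE[where \<chi> = "subst 0 x r \<^bold>= subst 0 y r"]) (auto intro!: ty)
qed

section \<open>The pigeonhole principle on truth values\<close>

text \<open>Written as an implication, the value requires no decision whether \<open>t\<close> is
  the extra point.\<close>

definition Switch :: "('b, 'c) tm \<Rightarrow> ('b, 'c) tm \<Rightarrow> ('b, 'c) tm" where
  "Switch u t = ((t \<^bold>= In_right Omega One Star) \<^bold>\<longrightarrow> u)"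

lemma lift_Switch [simp]: "lift k (Switch u t) = Switch (lift k u) (lift k t)"
  by (simp add: Switch_def)

lemma subst_Switch [simp]: "subst k s (Switch u t) = Switch (subst k s u) (subst k s t)"
  by (simp add: Switch_def)

lemma has_type_Switch:
  "has_type S \<Delta> u Omega \<Longrightarrow> has_type S \<Delta> t (Plus_ty Omega One) \<Longrightarrow> has_type S \<Delta> (Switch u t) Omega"
  by (auto simp: Switch_def intro!: typing)

text \<open>The premise \<open>left\<close> treats \<open>a = u\<close> and \<open>a = \<top>\<close> alike: all that matters is that \<open>u\<close> entails
  \<open>a\<close>.  The sets \<open>\<Gamma>'\<close> absorb the case hypotheses.\<close>

lemma Plus_one_propE:
  assumes t: "has_type S \<Delta> t (Plus_ty Omega One)" and u: "has_type S \<Delta> u Omega"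
    and mem: "proves S \<Delta> \<Gamma> (t \<^bold>\<in> Plus_one Omega (Doubleton Omega u Truth))"
    and left: "\<And>a \<Gamma>'. \<Gamma> \<subseteq> \<Gamma>' \<Longrightarrow> has_type S \<Delta> a Omega \<Longrightarrow> proves S \<Delta> (insert u \<Gamma>') a
      \<Longrightarrow> proves S \<Delta> \<Gamma>' (t \<^bold>= In_left Omega One a) \<Longrightarrow> proves S \<Delta> \<Gamma>' \<chi>"
    and right: "\<And>\<Gamma>'. \<Gamma> \<subseteq> \<Gamma>' \<Longrightarrow> proves S \<Delta> \<Gamma>' (t \<^bold>= In_right Omega One Star) \<Longrightarrow> proves S \<Delta> \<Gamma>' \<chi>"
  shows "proves S \<Delta> \<Gamma> \<chi>"
proof (rule DisjE[OF Mem_Plus_one_DoubletonD[OF t u ty_Truth mem]])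
  note ty = t u typing
  show "proves S \<Delta> (insert (t \<^bold>= In_left Omega One u) \<Gamma>) \<chi>"
    \<comment> \<open>For \<open>a = u\<close>, that \<open>u\<close> entails \<open>a\<close> is a
      hypothesis; for \<open>Truth\<close>, below, it is \<open>TruthI\<close>.\<close>
    by (rule left[where a = u]; (rule Hyp)?) (auto intro!: ty)
  let ?D = "(t \<^bold>= In_left Omega One Truth) \<^bold>\<or> (t \<^bold>= In_right Omega One Star)"
  have D: "proves S \<Delta> (insert ?D \<Gamma>) ?D"
    by (rule Hyp) (auto intro!: ty)
  show "proves S \<Delta> (insert ?D \<Gamma>) \<chi>"
  proof (rule DisjE[OF D])
    show "proves S \<Delta> (insert (t \<^bold>= In_left Omega One Truth) (insert ?D \<Gamma>)) \<chi>"
      by (rule left[OF _ ty_Truth TruthI Hyp]) (auto intro!: ty)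
    show "proves S \<Delta> (insert (t \<^bold>= In_right Omega One Star) (insert ?D \<Gamma>)) \<chi>"
      by (rule right[OF _ Hyp]) (auto intro!: ty)
  qed
qed

text \<open>The premise of the implication would identify a left point with the right one.\<close>

lemma Switch_left:
  assumes t: "has_type S \<Delta> t (Plus_ty Omega One)" and u: "has_type S \<Delta> u Omega"
    and a: "has_type S \<Delta> a Omega" and eq: "proves S \<Delta> \<Gamma> (t \<^bold>= In_left Omega One a)"
  shows "proves S \<Delta> \<Gamma> (Switch u t)"
  unfolding Switch_def
proof (rule ImplI)
  let ?c = "In_right Omega One Star"
  have c: "has_type S \<Delta> ?c (Plus_ty Omega One)"
    and l: "has_type S \<Delta> (In_left Omega One a) (Plus_ty Omega One)"
    using a by (auto intro!: typing)
  show ty: "has_type S \<Delta> (t \<^bold>= ?c) Omega"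
    using t c by (rule ty_Equal)
  have "proves S \<Delta> (insert (t \<^bold>= ?c) \<Gamma>) (In_left Omega One a \<^bold>= ?c)"
    by (rule Equal_trans[OF l t c Equal_sym[OF t l weaken[OF eq]] Hyp[OF insertI1 ty]])
  then show "proves S \<Delta> (insert (t \<^bold>= ?c) \<Gamma>) u"
    by (rule FalsityE[OF In_left_neq_In_right[OF a ty_Star] u])
qed

lemma Switch_right:
  assumes t: "has_type S \<Delta> t (Plus_ty Omega One)" and u: "has_type S \<Delta> u Omega"
    and eq: "proves S \<Delta> \<Gamma> (t \<^bold>= In_right Omega One Star)"
  shows "proves S \<Delta> \<Gamma> (Switch u t \<^bold>= u)"
proof (intro Prop_Extensionality ConjI ImplI)
  have s: "has_type S \<Delta> (Switch u t) Omega"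
    using u t by (rule has_type_Switch)
  then show "has_type S \<Delta> (Switch u t) Omega" .
  show "proves S \<Delta> (insert (Switch u t) \<Gamma>) u"
    using Hyp[OF insertI1 s] weaken[OF eq] unfolding Switch_def by (rule ImplE)
  show "proves S \<Delta> (insert u \<Gamma>) (Switch u t)"
    unfolding Switch_def by (intro ImplI weaken[OF Hyp]) (use t u in \<open>auto intro!: typing\<close>)
qed (rule u)

text \<open>This makes the map land in \<open>X\<close>: left points go to \<open>Truth\<close>, the
  second member, and the extra point goes to \<open>u\<close>, the first.\<close>

lemma Switch_mem:
  assumes t: "has_type S \<Delta> t (Plus_ty Omega One)" and u: "has_type S \<Delta> u Omega"
    and mem: "proves S \<Delta> \<Gamma> (t \<^bold>\<in> Plus_one Omega (Doubleton Omega u Truth))"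
  shows "proves S \<Delta> \<Gamma> (Switch u t \<^bold>\<in> Doubleton Omega u Truth)"
proof (rule Plus_one_propE[OF t u mem])
  have s: "has_type S \<Delta> (Switch u t) Omega"
    using u t by (rule has_type_Switch)
  show "proves S \<Delta> \<Gamma>' (Switch u t \<^bold>\<in> Doubleton Omega u Truth)"
    if "has_type S \<Delta> a Omega" "proves S \<Delta> \<Gamma>' (t \<^bold>= In_left Omega One a)" for a \<Gamma>'
    using DoubletonI2[OF s u ty_Truth] Equal_TruthI[OF s] Switch_left[OF t u that] by blast
  show "proves S \<Delta> \<Gamma>' (Switch u t \<^bold>\<in> Doubleton Omega u Truth)"
    if "proves S \<Delta> \<Gamma>' (t \<^bold>= In_right Omega One Star)" for \<Gamma>'
    using DoubletonI1[OF s u ty_Truth] Switch_right[OF t u that] by blast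
qed

section \<open>Collisions of the map\<close>

text \<open>The value at the left point is true, hence so is the value at the extra point, which
  yields \<open>u\<close>.\<close>

lemma Switch_collision_mixed:
  assumes x: "has_type S \<Delta> x (Plus_ty Omega One)" and y: "has_type S \<Delta> y (Plus_ty Omega One)"
    and u: "has_type S \<Delta> u Omega" and a: "has_type S \<Delta> a Omega"
    and same: "proves S \<Delta> \<Gamma> (Switch u x \<^bold>= Switch u y)"
    and x_eq: "proves S \<Delta> \<Gamma> (x \<^bold>= In_left Omega One a)"
    and y_eq: "proves S \<Delta> \<Gamma> (y \<^bold>= In_right Omega One Star)"
  shows "proves S \<Delta> \<Gamma> u"
proof -
  have "proves S \<Delta> \<Gamma> (Switch u y)"
    using Equal_propD[OF has_type_Switch[OF u x] has_type_Switch[OF u y] same]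
      Switch_left[OF x u a x_eq] .
  then show ?thesis
    using y_eq unfolding Switch_def by (rule ImplE)
qed

text \<open>Four cases. A left and an extra point give \<open>u\<close>, in either order; two extra
  points contradict \<open>neq\<close>; two left points are injections of propositions entailed by
  \<open>u\<close>, so they coincide under \<open>u\<close>, and \<open>Neg u\<close>
  follows.\<close>

lemma Switch_collision:
  assumes x: "has_type S \<Delta> x (Plus_ty Omega One)" and y: "has_type S \<Delta> y (Plus_ty Omega One)"
    and u: "has_type S \<Delta> u Omega"
    and x_mem: "proves S \<Delta> \<Gamma> (x \<^bold>\<in> Plus_one Omega (Doubleton Omega u Truth))"
    and y_mem: "proves S \<Delta> \<Gamma> (y \<^bold>\<in> Plus_one Omega (Doubleton Omega u Truth))"
    and same: "proves S \<Delta> \<Gamma> (Switch u x \<^bold>= Switch u y)"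
    and neq: "proves S \<Delta> \<Gamma> (Neg (x \<^bold>= y))"
  shows "proves S \<Delta> \<Gamma> (u \<^bold>\<or> Neg u)"
proof -
  let ?l = "\<lambda>a. In_left Omega One a" and ?c = "In_right Omega One Star"
  have l: "has_type S \<Delta> (?l a) (Plus_ty Omega One)" if "has_type S \<Delta> a Omega" for a
    using that by (auto intro!: typing)
  have c: "has_type S \<Delta> ?c (Plus_ty Omega One)"
    by (auto intro!: typing)
  have u_neg: "has_type S \<Delta> (Neg u) Omega"
    using u by (auto intro!: typing)
  have same': "proves S \<Delta> \<Gamma> (Switch u y \<^bold>= Switch u x)"
    by (rule Equal_sym[OF has_type_Switch[OF u x] has_type_Switch[OF u y] same])
  have clash: "proves S \<Delta> \<Gamma>' Falsity" if \<Gamma>': "\<Gamma> \<subseteq> \<Gamma>'" and s: "has_type S \<Delta> s (Plus_ty Omega One)"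
    and "proves S \<Delta> \<Gamma>' (x \<^bold>= s)" "proves S \<Delta> \<Gamma>' (y \<^bold>= s)" for \<Gamma>' s
    by (rule ImplE[OF proves_mono[OF neq \<Gamma>'] Equal_trans[OF x s y that(3) Equal_sym[OF y s that(4)]]])
  show ?thesis
  proof (rule Plus_one_propE[OF x u x_mem])
    fix a \<Gamma>1
    assume \<Gamma>1: "\<Gamma> \<subseteq> \<Gamma>1" and a: "has_type S \<Delta> a Omega" and ua: "proves S \<Delta> (insert u \<Gamma>1) a"
      and xa: "proves S \<Delta> \<Gamma>1 (x \<^bold>= ?l a)"
    show "proves S \<Delta> \<Gamma>1 (u \<^bold>\<or> Neg u)"
    proof (rule Plus_one_propE[OF y u proves_mono[OF y_mem \<Gamma>1]])
      fix b \<Gamma>2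
      assume \<Gamma>2: "\<Gamma>1 \<subseteq> \<Gamma>2" and b: "has_type S \<Delta> b Omega" and ub: "proves S \<Delta> (insert u \<Gamma>2) b"
        and yb: "proves S \<Delta> \<Gamma>2 (y \<^bold>= ?l b)"
      let ?G = "insert u \<Gamma>2"
      have G: "\<Gamma> \<subseteq> ?G" "\<Gamma>1 \<subseteq> ?G" "insert u \<Gamma>1 \<subseteq> ?G"
        using \<Gamma>1 \<Gamma>2 by auto
      \<comment> \<open>Where \<open>d\<close> is derivable, propositional extensionality makes it
        equal to \<open>Truth\<close>.\<close>
      have at_Truth: "proves S \<Delta> ?G (z \<^bold>= ?l Truth)"
        if z: "has_type S \<Delta> z (Plus_ty Omega One)" and d: "has_type S \<Delta> d Omega"
          and "proves S \<Delta> ?G (z \<^bold>= ?l d)" and "proves S \<Delta> ?G d" for z d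
        by (rule Equal_subst[where \<phi> = "lift 0 z \<^bold>= In_left Omega One (Var 0)",
              OF Equal_TruthI[OF d that(4)] that(3)])
          (use z d in \<open>auto intro!: typing\<close>)
      have "proves S \<Delta> ?G Falsity"
        by (rule clash[OF G(1) l[OF ty_Truth]
              at_Truth[OF x a proves_mono[OF xa G(2)] proves_mono[OF ua G(3)]]
              at_Truth[OF y b weaken[OF yb] ub]])
      then show "proves S \<Delta> \<Gamma>2 (u \<^bold>\<or> Neg u)"
        by (rule DisjI2[OF ImplI[OF u] u])
    next
      fix \<Gamma>2
      assume \<Gamma>2: "\<Gamma>1 \<subseteq> \<Gamma>2" and yc: "proves S \<Delta> \<Gamma>2 (y \<^bold>= ?c)"
      have "proves S \<Delta> \<Gamma>2 u"
        using proves_mono[OF same] proves_mono[OF xa] \<Gamma>1 \<Gamma>2 yc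
        by (intro Switch_collision_mixed[OF x y u a]) auto
      then show "proves S \<Delta> \<Gamma>2 (u \<^bold>\<or> Neg u)"
        using u_neg by (rule DisjI1)
    qed
  next
    fix \<Gamma>1
    assume \<Gamma>1: "\<Gamma> \<subseteq> \<Gamma>1" and xc: "proves S \<Delta> \<Gamma>1 (x \<^bold>= ?c)"
    show "proves S \<Delta> \<Gamma>1 (u \<^bold>\<or> Neg u)"
    proof (rule Plus_one_propE[OF y u proves_mono[OF y_mem \<Gamma>1]])
      fix b \<Gamma>2
      assume \<Gamma>2: "\<Gamma>1 \<subseteq> \<Gamma>2" and b: "has_type S \<Delta> b Omega" and yb: "proves S \<Delta> \<Gamma>2 (y \<^bold>= ?l b)"
      have "proves S \<Delta> \<Gamma>2 u"
        using proves_mono[OF same'] proves_mono[OF xc] \<Gamma>1 \<Gamma>2 yb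
        by (intro Switch_collision_mixed[OF y x u b]) auto
      then show "proves S \<Delta> \<Gamma>2 (u \<^bold>\<or> Neg u)"
        using u_neg by (rule DisjI1)
    next
      fix \<Gamma>2
      assume \<Gamma>2: "\<Gamma>1 \<subseteq> \<Gamma>2" and yc: "proves S \<Delta> \<Gamma>2 (y \<^bold>= ?c)"
      have "proves S \<Delta> \<Gamma>2 Falsity"
        using \<Gamma>1 \<Gamma>2 proves_mono[OF xc \<Gamma>2] yc by (intro clash[OF _ c]) auto
      then show "proves S \<Delta> \<Gamma>2 (u \<^bold>\<or> Neg u)"
        using ty_Disj[OF u u_neg] by (rule FalsityE)
    qed
  qed
qed

section \<open>From the pigeonhole principle to excluded middle\<close>

text \<open>The context is arbitrary because \<open>u\<close> will be the variable bound in
  \<open>Excluded_middle\<close>.\<close>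

lemma excluded_middle_of_Pigeonhole:
  assumes u: "has_type S \<Delta> u Omega" and pigeonhole: "proves S \<Delta> \<Gamma> (Pigeonhole Omega)"
  shows "proves S \<Delta> \<Gamma> (u \<^bold>\<or> Neg u)"
proof -
  let ?T = "Plus_ty Omega One"
  define X where "X = Doubleton Omega u Truth"
  \<comment> \<open>\<open>Var 0\<close> stands for the point of \<open>X + 1\<close>, so
    \<open>u\<close> is lifted past it.\<close>
  define r where "r = Switch (lift 0 u) (Var 0)"
  define f where "f = Graph ?T Omega (Plus_one Omega X) r"
  have X: "has_type S \<Delta> X (Power Omega)"
    using u by (auto simp: X_def intro!: typing has_type_Doubleton)
  have P: "has_type S \<Delta> (Plus_one Omega X) (Power ?T)"
    using X by (auto intro!: typing)
  have r: "has_type S (?T # \<Delta>) r Omega"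
    using u by (auto simp: r_def intro!: typing has_type_Switch)
  have f: "has_type S \<Delta> f (Power (Times ?T Omega))"
    unfolding f_def using P r by (rule has_type_Graph)
  have maps: "proves S \<Delta> \<Gamma> (Forall ?T ((Var 0 \<^bold>\<in> lift 0 (Plus_one Omega X)) \<^bold>\<longrightarrow> (r \<^bold>\<in> lift 0 X)))"
    unfolding X_def r_def lift_defs lift_Doubleton lift.simps
    by (intro ForallI ImplI Switch_mem Hyp) (use u in \<open>auto intro!: typing has_type_Doubleton\<close>)
  \<comment> \<open>The matrix of the conclusion of \<open>Pigeonhole\<close>, abstracted over
    \<open>X\<close> and \<open>f\<close>, which are instantiated one after the other.
    \<open>Var 1\<close> and \<open>Var 0\<close> are the colliding points.\<close>
  let ?E = "\<lambda>X f. (Var 1 \<^bold>\<in> Plus_one Omega X) \<^bold>\<and> (Var 0 \<^bold>\<in> Plus_one Omega X) \<^bold>\<and>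
    Same_value Omega f (Var 1) (Var 0) \<^bold>\<and> Neg (Var 1 \<^bold>= Var 0)"
  have "proves S \<Delta> \<Gamma> (Finite Omega X \<^bold>\<longrightarrow>
      Forall (Power (Times ?T Omega))
        (Function ?T Omega (Plus_one Omega (lift 0 X)) (lift 0 X) (Var 0) \<^bold>\<longrightarrow>
          Exists ?T (Exists ?T (?E (lift3 X) (Var 2)))))"
    \<comment> \<open>Numerals are unfolded to successors so that the index comparisons in
      \<open>subst\<close> compute.\<close>
    using ForallE[OF pigeonhole[unfolded Pigeonhole_def] X] by (simp add: eval_nat_numeral)
  moreover have "proves S \<Delta> \<Gamma> (Finite Omega X)"
    unfolding X_def using u ty_Truth by (rule Finite_Doubleton)
  ultimately have all: "proves S \<Delta> \<Gamma> (Forall (Power (Times ?T Omega))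
        (Function ?T Omega (Plus_one Omega (lift 0 X)) (lift 0 X) (Var 0) \<^bold>\<longrightarrow>
          Exists ?T (Exists ?T (?E (lift3 X) (Var 2)))))"
    by (rule ImplE)
  have "proves S \<Delta> \<Gamma> (Function ?T Omega (Plus_one Omega X) X f \<^bold>\<longrightarrow>
      Exists ?T (Exists ?T (?E (lift2 X) (lift2 f))))"
    using ForallE[OF all f] by (simp add: eval_nat_numeral)
  moreover have "proves S \<Delta> \<Gamma> (Function ?T Omega (Plus_one Omega X) X f)"
    unfolding f_def using P X r maps by (rule Function_Graph)
  ultimately have ex: "proves S \<Delta> \<Gamma> (Exists ?T (Exists ?T (?E (lift2 X) (lift2 f))))"
    by (rule ImplE)
  let ?D = "?T # ?T # \<Delta>"
  have E_type: "has_type S ?D (?E (lift2 X) (lift2 f)) Omega"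
    using X f by (auto intro!: typing)
  \<comment> \<open>\<open>\<Gamma>'\<close> is arbitrary, since two nested uses of
    \<open>ExistsE\<close> surround the matrix with further lifted assumptions.\<close>
  have main: "proves S ?D \<Gamma>' (lift2 (u \<^bold>\<or> Neg u))" if "?E (lift2 X) (lift2 f) \<in> \<Gamma>'" for \<Gamma>'
  proof -
    have E: "proves S ?D \<Gamma>' (?E (lift2 X) (lift2 f))"
      by (rule Hyp[OF that E_type])
    have "proves S ?D \<Gamma>' (Same_value Omega
        (Graph ?T Omega (Plus_one Omega (lift2 X)) (Switch (lift3 u) (Var 0))) (Var 1) (Var 0))"
      using ConjE1[OF ConjE2[OF ConjE2[OF E]]] by (simp add: f_def r_def)
    then have "proves S ?D \<Gamma>' (subst 0 (Var 1) (Switch (lift3 u) (Var 0)) \<^bold>=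
        subst 0 (Var 0) (Switch (lift3 u) (Var 0)))"
      by (rule Same_value_Graph[rotated -1]) (use X u in \<open>auto intro!: typing has_type_Switch\<close>)
    then have "proves S ?D \<Gamma>' (Switch (lift2 u) (Var 1) \<^bold>= Switch (lift2 u) (Var 0))"
      by simp
    then have "proves S ?D \<Gamma>' (lift2 u \<^bold>\<or> Neg (lift2 u))"
      using ConjE1[OF E] ConjE1[OF ConjE2[OF E]] ConjE2[OF ConjE2[OF ConjE2[OF E]]] u
      by (intro Switch_collision[of S ?D "Var 1" "Var 0"]) (auto simp: X_def intro!: typing)
    then show ?thesis by simp
  qed
  show ?thesis
  proof (rule ExistsE[OF ex])
    show "has_type S \<Delta> (u \<^bold>\<or> Neg u) Omega"
      using u by (auto intro!: typing)
    then have ty: "has_type S (?T # \<Delta>) (lift 0 (u \<^bold>\<or> Neg u)) Omega"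
      by (rule has_type_lift)
    show "proves S (?T # \<Delta>) (insert (Exists ?T (?E (lift2 X) (lift2 f))) (lift 0 ` \<Gamma>))
        (lift 0 (u \<^bold>\<or> Neg u))"
      by (rule ExistsE[OF Hyp[OF insertI1] ty main]) (use E_type in \<open>auto intro: ty_Exists\<close>)
  qed
qed

theorem theorem4:
  fixes S :: "'c \<rightharpoonup> 'b ty" and \<Gamma> :: "('b, 'c) tm set"
  assumes "\<And>A. proves S [] \<Gamma> (Pigeonhole A)"
  shows "proves S [] \<Gamma> Excluded_middle"
\<comment> \<open>The instance at \<open>Omega\<close> becomes a hypothesis. Being closed, it is
  unchanged by the lift in \<open>ForallI\<close>, and so it is available in the context
  \<open>[Omega]\<close>, where \<open>u\<close> is \<open>Var 0\<close>.\<close>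
proof (rule cut[OF _ assms[of Omega]])
  have ty: "has_type S \<Delta> (Pigeonhole Omega) Omega" for \<Delta>
    unfolding Pigeonhole_def by (auto intro!: typing)
  then show "has_type S [] (Pigeonhole Omega) Omega" .
  have "lift 0 (Pigeonhole Omega) = (Pigeonhole Omega :: ('b, 'c) tm)"
    by (simp add: Pigeonhole_def)
  then have "proves S [Omega] (lift 0 ` insert (Pigeonhole Omega) \<Gamma>) (Pigeonhole Omega)"
    by (intro Hyp ty) simp
  then show "proves S [] (insert (Pigeonhole Omega) \<Gamma>) Excluded_middle"
    unfolding Excluded_middle_def
    by (intro ForallI excluded_middle_of_Pigeonhole ty_Var) auto
qed

end
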